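(* Let $m \in \mathbb{N}$ with $m > 2$. For integers $n \geq 2$ and $m \geq 3$, let $J_{n,m}$ denote the Jahangir graph and let $\sigma(J_{n,m})$ denote its number of spanning trees. Then $$\lim_{n \to \infty} \frac{\sigma(J_{n,m})}{\sigma(J_{n-1,m})} = 1.$$
   Context: For integers $n \geq 2$ and $m \geq 3$, the Jahangir graph $J_{n,m}$ is the simple graph on $nm+1$ vertices consisting of a cycle $C_{nm}$ on $nm$ vertices together with one additional (central) vertex that is adjacent to exactly $m$ vertices of $C_{nm}$, these $m$ vertices being at distance $n$ from each other along $C_{nm}$. A spanning tree of a finite simple connected graph $\mathcal{G}$ is a connected acyclic subgraph containing every vertex of $\mathcal{G}$; $\sigma(\mathcal{G})$ denotes the number of spanning trees of $\mathcal{G}$. In the limit, $n$ ranges over integers $n \geq 3$, so that both $J_{n,m}$ and $J_{n-1,m}$ are defined. *)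

theory Defs
  imports Complex_Main
begin

text \<open>
  Undirected graphs are a vertex set with a set of two-element edges. The AFP entry
  Graph_Theory is not suitable here: its notion of forest only excludes directed cycles, so that
  an acyclically oriented triangle counts as a tree there.
\<close>

record 'a ugraph =
  uverts :: "'a set"
  uedges :: "'a set set"

definition simple_graph :: "'a ugraph \<Rightarrow> bool" where
  "simple_graph G \<longleftrightarrow> finite (uverts G) \<and>
     uedges G \<subseteq> {{u, v} | u v. u \<in> uverts G \<and> v \<in> uverts G \<and> u \<noteq> v}"

definition adjacent :: "'a ugraph \<Rightarrow> 'a \<Rightarrow> 'a \<Rightarrow> bool" where
  "adjacent G u v \<longleftrightarrow> {u, v} \<in> uedges G"

definition is_walk :: "'a ugraph \<Rightarrow> 'a list \<Rightarrow> bool" where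
  "is_walk G xs \<longleftrightarrow> xs \<noteq> [] \<and> set xs \<subseteq> uverts G \<and> successively (adjacent G) xs"

definition connected_graph :: "'a ugraph \<Rightarrow> bool" where
  "connected_graph G \<longleftrightarrow> uverts G \<noteq> {} \<and>
     (\<forall>u \<in> uverts G. \<forall>v \<in> uverts G. \<exists>xs. is_walk G xs \<and> hd xs = u \<and> last xs = v)"

text \<open>A cycle is listed without repeating its first vertex at the end.\<close>

definition is_cycle :: "'a ugraph \<Rightarrow> 'a list \<Rightarrow> bool" where
  "is_cycle G xs \<longleftrightarrow>
     3 \<le> length xs \<and> distinct xs \<and> is_walk G xs \<and> adjacent G (last xs) (hd xs)"

definition acyclic_graph :: "'a ugraph \<Rightarrow> bool" where
  "acyclic_graph G \<longleftrightarrow> (\<nexists>xs. is_cycle G xs)"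

definition is_subgraph :: "'a ugraph \<Rightarrow> 'a ugraph \<Rightarrow> bool" where
  "is_subgraph H G \<longleftrightarrow> simple_graph H \<and> uverts H \<subseteq> uverts G \<and> uedges H \<subseteq> uedges G"

definition is_spanning_tree :: "'a ugraph \<Rightarrow> 'a ugraph \<Rightarrow> bool" where
  "is_spanning_tree T G \<longleftrightarrow>
     is_subgraph T G \<and> uverts T = uverts G \<and> connected_graph T \<and> acyclic_graph T"

definition num_spanning_trees :: "'a ugraph \<Rightarrow> nat" where
  "num_spanning_trees G = card {T. is_spanning_tree T G}"

datatype jvertex = Centre | Rim nat

text \<open>
  The rim is the cycle through \<open>Rim 0, \<dots>, Rim (n * m - 1)\<close>, and the centre is joined to
  every \<open>n\<close>-th rim vertex. Meaningful for \<open>n \<ge> 2\<close> and \<open>m \<ge> 3\<close>.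
\<close>

definition jahangir :: "nat \<Rightarrow> nat \<Rightarrow> jvertex ugraph" where
  "jahangir n m =
     \<lparr> uverts = insert Centre (Rim ` {..<n * m}),
       uedges = {{Rim i, Rim ((i + 1) mod (n * m))} | i. i < n * m}
              \<union> {{Centre, Rim (n * k)} | k. k < m} \<rparr>"

lemma simple_graph_jahangir:
  assumes "n \<ge> 2" "m \<ge> 3"
  shows "simple_graph (jahangir n m)"
proof -
  have nm: "n * m \<ge> 2"
    using mult_le_mono[OF assms] by simp
  have ml: "(i + 1) mod (n * m) < n * m" for i
    using nm by (intro mod_less_divisor) linarith
  have rim: "\<exists>u v. {Rim i, Rim ((i + 1) mod (n * m))} = {u, v} \<and>
      u \<in> insert Centre (Rim ` {..<n * m}) \<and> v \<in> insert Centre (Rim ` {..<n * m}) \<and> u \<noteq> v"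
    if i: "i < n * m" for i
  proof (intro exI conjI)
    show "Rim i \<noteq> Rim ((i + 1) mod (n * m))"
      using nm i by (cases "i + 1 = n * m") auto
  qed (use i ml[of i] in auto)
  have spoke: "\<exists>u v. {Centre, Rim (n * k)} = {u, v} \<and>
      u \<in> insert Centre (Rim ` {..<n * m}) \<and> v \<in> insert Centre (Rim ` {..<n * m}) \<and> u \<noteq> v"
    if "k < m" for k
    by (rule exI[of _ Centre], rule exI[of _ "Rim (n * k)"]) (use assms that in auto)
  show ?thesis
    unfolding simple_graph_def jahangir_def using rim spoke by auto
qed

lemma card_uverts_jahangir: "card (uverts (jahangir n m)) = n * m + 1"
  by (simp add: jahangir_def card_insert_if card_image inj_on_def image_iff)

lemma finite_spanning_trees:
  assumes "simple_graph G"
  shows "finite {T. is_spanning_tree T G}"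
proof (rule finite_subset)
  show "{T. is_spanning_tree T G} \<subseteq>
      (\<lambda>E. \<lparr>uverts = uverts G, uedges = E\<rparr>) ` Pow (Pow (uverts G))"
  proof
    fix T :: "'a ugraph" assume "T \<in> {T. is_spanning_tree T G}"
    then have "uverts T = uverts G" "uedges T \<subseteq> Pow (uverts G)"
      by (auto simp: is_spanning_tree_def is_subgraph_def simple_graph_def)
    then show "T \<in> (\<lambda>E. \<lparr>uverts = uverts G, uedges = E\<rparr>) ` Pow (Pow (uverts G))"
      by (intro image_eqI[of _ _ "uedges T"]) auto
  qed
  show "finite ((\<lambda>E. \<lparr>uverts = uverts G, uedges = E\<rparr>) ` Pow (Pow (uverts G)))"
    using assms by (simp add: simple_graph_def)
qed

end

theory Submission
  imports Defs "HOL-Library.FuncSet"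
begin

text \<open>
  Record a spanning subgraph of \<open>J\<^bsub>n,m\<^esub>\<close> by the set \<open>R\<close> of deleted rim edges and the set \<open>D\<close> of
  kept spokes. If it is connected, each of the \<open>m\<close> rim segments of length \<open>n\<close> loses at
  most one edge, and whether it is connected then depends only on \<open>D\<close> and on the set \<open>A\<close> of
  segments that lose an edge, neither on the positions of the lost edges nor on \<open>n\<close>. A spanning
  tree is a minimal connected spanning subgraph, so the same holds for being a spanning tree. Hence
  \<open>\<sigma>(J\<^bsub>n,m\<^esub>) = \<Sum> n\<^bsup>card A\<^esup>\<close>, summed over a nonempty finite set of
  pairs \<open>(A, D)\<close> with \<open>card A \<le> m\<close> that depends on \<open>m\<close> alone, and therefore
  \<open>1 \<le> \<sigma>(J\<^bsub>n,m\<^esub>) / \<sigma>(J\<^bsub>n-1,m\<^esub>) \<le> (n / (n - 1))\<^bsup>m\<^esup>\<close>.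
\<close>

section \<open>Spanning trees as minimal connected subgraphs\<close>

text \<open>Two-colourings that are constant on connected components. They replace walks in all
  later connectivity arguments, because a disconnection is witnessed by one explicit
  predicate.\<close>

definition edge_invariant :: "'a ugraph \<Rightarrow> ('a \<Rightarrow> bool) \<Rightarrow> bool" where
  "edge_invariant G P \<longleftrightarrow> (\<forall>u v. {u, v} \<in> uedges G \<longrightarrow> P u = P v)"

definition delete_edge :: "'a set \<Rightarrow> 'a ugraph \<Rightarrow> 'a ugraph" where
  "delete_edge e G = \<lparr>uverts = uverts G, uedges = uedges G - {e}\<rparr>"

lemma delete_edge_simps [simp]:
  "uverts (delete_edge e G) = uverts G"
  "uedges (delete_edge e G) = uedges G - {e}"
  by (simp_all add: delete_edge_def)

lemma simple_graph_edgeD: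
  assumes "simple_graph G" "{u, v} \<in> uedges G"
  shows "u \<in> uverts G" "v \<in> uverts G" "u \<noteq> v"
  using assms unfolding simple_graph_def by (auto simp: doubleton_eq_iff)

lemma simple_graph_delete_edge: "simple_graph G \<Longrightarrow> simple_graph (delete_edge e G)"
  by (auto simp: simple_graph_def)

lemma edge_invariant_walk:
  assumes "edge_invariant G P" "is_walk G xs"
  shows "P (hd xs) = P (last xs)"
  using assms(2)
proof (induction xs rule: induct_list012)
  case (3 x y zs)
  then have "{x, y} \<in> uedges G" "is_walk G (y # zs)"
    by (simp_all add: is_walk_def adjacent_def)
  then have "P x = P y" "P y = P (last (y # zs))"
    using assms(1) "3.IH" by (simp_all add: edge_invariant_def)
  then show ?case by simp
qed (auto simp: is_walk_def)

text \<open>An invariant predicate keeps its value along a walk. Conversely, reachability from a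
  fixed vertex is itself invariant, so if it is constant, every vertex is reachable.\<close>

lemma connected_graph_iff_edge_invariant:
  assumes "simple_graph G"
  shows "connected_graph G \<longleftrightarrow> uverts G \<noteq> {} \<and>
    (\<forall>P. edge_invariant G P \<longrightarrow> (\<forall>u\<in>uverts G. \<forall>v\<in>uverts G. P u = P v))"
proof
  assume "connected_graph G"
  then show "uverts G \<noteq> {} \<and>
      (\<forall>P. edge_invariant G P \<longrightarrow> (\<forall>u\<in>uverts G. \<forall>v\<in>uverts G. P u = P v))"
    unfolding connected_graph_def using edge_invariant_walk by metis
next
  assume *: "uverts G \<noteq> {} \<and>
      (\<forall>P. edge_invariant G P \<longrightarrow> (\<forall>u\<in>uverts G. \<forall>v\<in>uverts G. P u = P v))"
  show "connected_graph G"
    unfolding connected_graph_def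
  proof (intro conjI ballI)
    fix u v assume uv: "u \<in> uverts G" "v \<in> uverts G"
    define P where "P = (\<lambda>x. \<exists>xs. is_walk G xs \<and> hd xs = u \<and> last xs = x)"
    have ext: "P y" if "P x" "{x, y} \<in> uedges G" for x y
    proof -
      from that obtain xs where xs: "is_walk G xs" "hd xs = u" "last xs = x"
        by (auto simp: P_def)
      have "is_walk G (xs @ [y])"
        using xs that simple_graph_edgeD[OF assms that(2)]
        by (auto simp: is_walk_def successively_append_iff adjacent_def)
      then show ?thesis
        using xs by (auto simp: P_def is_walk_def intro!: exI[of _ "xs @ [y]"])
    qed
    have "edge_invariant G P"
      unfolding edge_invariant_def using ext by (metis insert_commute)
    moreover have "P u"
      using uv by (auto simp: P_def is_walk_def intro!: exI[of _ "[u]"])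
    ultimately show "\<exists>xs. is_walk G xs \<and> hd xs = u \<and> last xs = v"
      using * uv unfolding P_def by blast
  qed (use * in blast)
qed

text \<open>Cutting out the closed part between two visits to the same vertex shortens a walk and
  keeps its ends.\<close>

lemma distinct_walk:
  assumes "is_walk G xs"
  obtains ys where "is_walk G ys" "distinct ys" "hd ys = hd xs" "last ys = last xs"
  using assms
proof (induction "length xs" arbitrary: xs thesis rule: less_induct)
  case less
  show ?case
  proof (cases "distinct xs")
    case False
    then obtain as bs cs y where xs: "xs = as @ [y] @ bs @ [y] @ cs"
      using not_distinct_decomp by blast
    have "is_walk G (as @ [y] @ cs)"
      using less.prems(2) unfolding xs
      by (cases cs) (auto simp: is_walk_def successively_append_iff successively_Cons)
    moreover have "hd (as @ [y] @ cs) = hd xs" "last (as @ [y] @ cs) = last xs"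
      by (cases as; auto simp: xs)+
    moreover have "length (as @ [y] @ cs) < length xs" by (simp add: xs)
    ultimately show ?thesis using less.hyps less.prems(1) by metis
  qed (use less.prems in auto)
qed

lemma is_walk_delete_edge: "is_walk (delete_edge e G) xs \<Longrightarrow> is_walk G xs"
  unfolding is_walk_def adjacent_def by (auto elim: successively_mono)

text \<open>If the graph stays connected without \<open>e\<close>, a path between the ends of
  \<open>e\<close> closes up with \<open>e\<close> to a cycle. Conversely, the rest of a cycle links
  the ends of its closing edge, so deleting that edge keeps the graph connected.\<close>

lemma acyclic_graph_iff_bridges:
  assumes simple: "simple_graph G" and conn: "connected_graph G"
  shows "acyclic_graph G \<longleftrightarrow> (\<forall>e\<in>uedges G. \<not> connected_graph (delete_edge e G))"
proof (intro iffI ballI notI)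
  fix e assume acyc: "acyclic_graph G" and e: "e \<in> uedges G"
    and conn': "connected_graph (delete_edge e G)"
  from e simple obtain u v where uv: "e = {u, v}" "u \<in> uverts G" "v \<in> uverts G" "u \<noteq> v"
    unfolding simple_graph_def by blast
  obtain zs where "is_walk (delete_edge e G) zs" "hd zs = u" "last zs = v"
    using conn' uv unfolding connected_graph_def by auto
  then obtain xs where xs: "is_walk (delete_edge e G) xs" "distinct xs" "hd xs = u" "last xs = v"
    by (metis distinct_walk)
  have "3 \<le> length xs"
  proof (rule ccontr)
    assume "\<not> 3 \<le> length xs"
    moreover have "length xs \<noteq> 0" "length xs \<noteq> 1"
      using xs uv by (auto simp: is_walk_def length_Suc_conv)
    ultimately have "length xs = 2" by linarith
    then have "xs = [u, v]"
      using xs by (auto simp: numeral_2_eq_2 length_Suc_conv)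
    then show False
      using xs(1) uv by (simp add: is_walk_def adjacent_def)
  qed
  moreover have "adjacent G (last xs) (hd xs)"
    using xs e uv by (simp add: adjacent_def insert_commute)
  ultimately have "is_cycle G xs"
    using xs is_walk_delete_edge by (auto simp: is_cycle_def)
  then show False using acyc by (auto simp: acyclic_graph_def)
next
  assume bridges: "\<forall>e\<in>uedges G. \<not> connected_graph (delete_edge e G)"
  show "acyclic_graph G"
    unfolding acyclic_graph_def
  proof
    assume "\<exists>xs. is_cycle G xs"
    then obtain xs where xs: "3 \<le> length xs" "distinct xs" "is_walk G xs"
      "{last xs, hd xs} \<in> uedges G"
      by (auto simp: is_cycle_def adjacent_def)
    define e where "e = {last xs, hd xs}"
    have ne: "xs \<noteq> []" using xs by auto
    \<comment> \<open>The path from \<open>hd xs\<close> to \<open>last xs\<close> must avoid the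
      closing edge. Distinctness leaves only \<open>xs\<close> of length two as an exception, which
      the length bound excludes.\<close>
    have "{xs ! i, xs ! Suc i} \<noteq> e" if "Suc i < length xs" for i
    proof
      assume "{xs ! i, xs ! Suc i} = e"
      then have "xs ! i = xs ! (length xs - 1) \<and> xs ! Suc i = xs ! 0 \<or>
          xs ! i = xs ! 0 \<and> xs ! Suc i = xs ! (length xs - 1)"
        by (simp add: e_def doubleton_eq_iff last_conv_nth hd_conv_nth ne)
      then have "i = length xs - 1 \<or> i = 0 \<and> Suc i = length xs - 1"
        using that nth_eq_iff_index_eq[OF xs(2), of i "length xs - 1"]
          nth_eq_iff_index_eq[OF xs(2), of i 0]
          nth_eq_iff_index_eq[OF xs(2), of "Suc i" "length xs - 1"]
        by (metis Suc_lessD diff_less length_greater_0_conv less_numeral_extra(1) ne)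
      then show False using that xs(1) by auto
    qed
    then have walk: "is_walk (delete_edge e G) xs"
      using xs(3) by (auto simp: is_walk_def successively_conv_nth adjacent_def)
    have "edge_invariant G P" if P: "edge_invariant (delete_edge e G) P" for P
      unfolding edge_invariant_def
    proof (intro allI impI)
      fix u v assume "{u, v} \<in> uedges G"
      moreover have "P (hd xs) = P (last xs)"
        by (rule edge_invariant_walk[OF P walk])
      ultimately show "P u = P v"
        using P by (cases "{u, v} = e") (auto simp: edge_invariant_def e_def doubleton_eq_iff)
    qed
    then have "connected_graph (delete_edge e G)"
      using conn unfolding connected_graph_iff_edge_invariant[OF simple]
        connected_graph_iff_edge_invariant[OF simple_graph_delete_edge[OF simple]] by auto
    then show False using bridges xs(4) by (simp add: e_def)
  qed
qed

section \<open>Connectivity of a rim with spokes\<close>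

text \<open>
  The rim has edges \<open>k \<midarrow> (k + 1) mod N\<close> for \<open>k < N\<close>; those in \<open>R\<close> are deleted,
  and the vertices in \<open>S\<close> are joined to the centre. Here \<open>P\<close> and \<open>c\<close> are the values of
  an edge-invariant predicate on the rim and at the centre.
\<close>

definition rim_connected :: "nat \<Rightarrow> nat set \<Rightarrow> nat set \<Rightarrow> bool" where
  "rim_connected N R S \<longleftrightarrow>
     (\<forall>P c. (\<forall>k<N. k \<notin> R \<longrightarrow> P k = P ((k + 1) mod N)) \<longrightarrow> (\<forall>k\<in>S. P k = c) \<longrightarrow>
       (\<forall>k<N. P k = (c :: bool)))"

text \<open>The bridge criterion for spanning trees, stated for index sets alone, so that it can be
  compared between the rim of length \<open>n * m\<close> and the contracted rim of length
  \<open>m\<close>.\<close>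

definition rim_tree :: "nat \<Rightarrow> nat set \<Rightarrow> nat set \<Rightarrow> bool" where
  "rim_tree N R S \<longleftrightarrow> rim_connected N R S \<and>
     (\<forall>k<N. k \<notin> R \<longrightarrow> \<not> rim_connected N (insert k R) S) \<and>
     (\<forall>k\<in>S. \<not> rim_connected N R (S - {k}))"

lemma rim_connectedD:
  assumes "rim_connected N R S"
    and "\<And>k. k < N \<Longrightarrow> k \<notin> R \<Longrightarrow> P k = P ((k + 1) mod N)"
    and "\<And>k. k \<in> S \<Longrightarrow> P k = c" and "k < N"
  shows "P k = (c :: bool)"
  using assms(1)[unfolded rim_connected_def, rule_format, of P c k] assms(2-) by auto

text \<open>The end \<open>b = N\<close> is allowed and stands for vertex \<open>0\<close>, so the
  last segment, which closes the cycle, needs no separate treatment.\<close>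

lemma constant_along_rim:
  fixes a b :: nat
  assumes step: "\<And>k. k < N \<Longrightarrow> k \<notin> R \<Longrightarrow> P k = P ((k + 1) mod N)"
    and "a < N" "a \<le> b" "b \<le> N" "\<And>k. a \<le> k \<Longrightarrow> k < b \<Longrightarrow> k \<notin> R"
  shows "P a = P (b mod N)"
  using assms(3-)
proof (induction b rule: dec_induct)
  case base
  then show ?case using \<open>a < N\<close> by simp
next
  case (step k)
  then have "P a = P k" by simp
  also have "\<dots> = P ((k + 1) mod N)"
    using step.prems step.hyps by (intro assms(1)) auto
  finally show ?case by simp
qed

lemma segment_bounds:
  fixes n m x :: nat
  assumes "x < n * m"
  shows "x div n < m" "n * (x div n) \<le> x" "x < n * (x div n + 1)" "n * (x div n + 1) \<le> n * m"
proof -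
  have n: "0 < n" using assms by (cases n) auto
  show *: "x div n < m" using assms by (simp add: less_mult_imp_div_less mult.commute)
  show "n * (x div n) \<le> x" by simp
  show "x < n * (x div n + 1)"
    using n dividend_less_times_div[of n x] by simp
  show "n * (x div n + 1) \<le> n * m" using * by (intro mult_le_mono2) simp
qed

text \<open>Contract every segment to its first vertex, the only one that can carry a spoke. Two
  gaps in one segment cut off the vertices between them. With at most one gap, the vertices before
  it hang on the start of their own segment and those after it on the next start, so only the
  presence of a gap matters.\<close>

lemma rim_connected_segments:
  assumes n: "0 < n" and R: "R \<subseteq> {..<n * m}" and D: "D \<subseteq> {..<m}"
  shows "rim_connected (n * m) R ((*) n ` D) \<longleftrightarrow>
    inj_on (\<lambda>i. i div n) R \<and> rim_connected m ((\<lambda>i. i div n) ` R) D"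
proof (intro iffI conjI)
  assume conn: "rim_connected (n * m) R ((*) n ` D)"
  have no_two: False if ij: "i \<in> R" "j \<in> R" "i div n = j div n" "i < j" for i j
  proof -
    \<comment> \<open>The block \<open>i + 1, ..., j\<close> lies between the deleted edges
      \<open>i\<close> and \<open>j\<close> and contains no multiple of \<open>n\<close>, hence no
      spoke.\<close>
    define P where "P = (\<lambda>x. i < x \<and> x \<le> j)"
    have j: "j < n * m" using R ij by auto
    have "P j = False"
    proof (rule rim_connectedD[OF conn _ _ j])
      fix k assume k: "k < n * m" "k \<notin> R"
      then have "k \<noteq> i" "k \<noteq> j" using ij by auto
      then show "P k = P ((k + 1) mod (n * m))"
        using k j by (cases "k + 1 = n * m") (auto simp: P_def)
    next
      fix s assume "s \<in> (*) n ` D"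
      then obtain k where k: "s = n * k" by auto
      show "P s = False"
      proof (rule ccontr)
        assume "P s \<noteq> False"
        then have s: "i < s" "s \<le> j" by (auto simp: P_def)
        then have "i div n \<le> k" "k \<le> j div n"
          using n div_le_mono[of i s n] div_le_mono[of s j n] by (auto simp: k)
        then have "k = i div n" using ij by simp
        then have "s \<le> i" by (simp only: k times_div_less_eq_dividend)
        then show False using s(1) by simp
      qed
    qed
    then show False using ij by (simp add: P_def)
  qed
  show "inj_on (\<lambda>i. i div n) R"
  proof (rule inj_onI)
    fix i j assume "i \<in> R" "j \<in> R" "i div n = j div n"
    then show "i = j"
      using no_two[of i j] no_two[of j i] by (cases i j rule: linorder_cases) simp_all
  qed
  show "rim_connected m ((\<lambda>i. i div n) ` R) D"
    unfolding rim_connected_def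
  proof (intro allI impI)
    fix Q c k
    assume Q: "\<forall>k<m. k \<notin> (\<lambda>i. i div n) ` R \<longrightarrow> Q k = Q ((k + 1) mod m)"
      and c: "\<forall>k\<in>D. Q k = (c :: bool)" and k: "k < m"
    \<comment> \<open>This extends \<open>Q\<close> from segment starts to the whole rim. Edge
      \<open>r\<close> joins \<open>r\<close> to \<open>r + 1\<close>, so \<open>r\<close> itself
      still takes the value of its own start; only vertices \<open>x\<close> with
      \<open>r < x\<close> take that of the next one.\<close>
    define P where "P = (\<lambda>x. if \<exists>r\<in>R. r div n = x div n \<and> r < x
      then Q ((x div n + 1) mod m) else Q (x div n))"
    have P_start: "P (n * k) = Q k" for k
    proof -
      have "\<not> r < n * k" if "r div n = k" for r
        using that by (auto simp: not_less)
      then show ?thesis using n by (auto simp: P_def)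
    qed
    have "P (n * k) = c"
    proof (rule rim_connectedD[OF conn])
      show "n * k < n * m" using n k by simp
      fix s assume "s \<in> (*) n ` D"
      then show "P s = c" using c P_start by auto
    next
      fix x assume x: "x < n * m" "x \<notin> R"
      note b = segment_bounds[OF x(1)]
      show "P x = P ((x + 1) mod (n * m))"
      \<comment> \<open>Only the edge at the last vertex of a segment leaves the segment. Any other
        kept edge stays on one side of the gap.\<close>
      proof (cases "x + 1 = n * (x div n + 1)")
        case False
        then have x': "x + 1 < n * (x div n + 1)" using b(3) by linarith
        then have "x + 1 < n * m" using b(4) by linarith
        moreover have "(x + 1) div n = x div n"
          using x' le_SucI[OF b(2)] by (intro div_nat_eqI) (simp_all add: mult.commute)
        moreover have "r < x + 1 \<longleftrightarrow> r < x" if "r \<in> R" for r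
          using that x by (metis Suc_eq_plus1 less_Suc_eq)
        ultimately show ?thesis by (auto simp: P_def)
      next
        case True
        have "P ((x + 1) mod (n * m)) = P (n * ((x div n + 1) mod m))"
          by (subst True) (simp only: mod_mult_mult1)
        also have "\<dots> = Q ((x div n + 1) mod m)" by (rule P_start)
        also have "\<dots> = P x"
        proof (cases "x div n \<in> (\<lambda>i. i div n) ` R")
          case in_A: True
          then obtain r where r: "r \<in> R" "r div n = x div n" by auto
          have "r < n * m" using r R by auto
          from segment_bounds(3)[OF this] have "r < x + 1" using r True by simp
          moreover have "r \<noteq> x" using r x by auto
          ultimately have "r < x" by simp
          then show ?thesis using r by (auto simp: P_def)
        next
          case False
          then show ?thesis using Q b(1) by (auto simp: P_def)
        qed
        finally show ?thesis ..
      qed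
    qed
    then show "Q k = c" by (simp add: P_start)
  qed
next
  assume "inj_on (\<lambda>i. i div n) R \<and> rim_connected m ((\<lambda>i. i div n) ` R) D"
  then have inj: "inj_on (\<lambda>i. i div n) R"
    and conn: "rim_connected m ((\<lambda>i. i div n) ` R) D" by auto
  show "rim_connected (n * m) R ((*) n ` D)"
    unfolding rim_connected_def
  proof (intro allI impI)
    fix P c x
    assume P: "\<forall>k<n * m. k \<notin> R \<longrightarrow> P k = P ((k + 1) mod (n * m))"
      and c: "\<forall>k\<in>(*) n ` D. P k = (c :: bool)" and x: "x < n * m"
    note const = constant_along_rim[of "n * m" R P, OF P[rule_format]]
    have seg: "r div n = k" if "n * k \<le> r" "r < n * (k + 1)" for r k
      using that by (intro div_nat_eqI) (auto simp: mult.commute)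
    \<comment> \<open>Restricted to segment starts, \<open>P\<close> is a colouring of the
      contracted rim: a segment without a gap carries the value of its start to the next
      start.\<close>
    have start: "P (n * k) = c" if "k < m" for k
    proof (rule rim_connectedD[OF conn _ _ that, where P = "\<lambda>k. P (n * k)"])
      fix k assume k: "k < m" "k \<notin> (\<lambda>i. i div n) ` R"
      have "P (n * k) = P ((n * (k + 1)) mod (n * m))"
      proof (rule const)
        show "n * k < n * m" using k n by simp
        show "n * k \<le> n * (k + 1)" by simp
        show "n * (k + 1) \<le> n * m" using k by (intro mult_le_mono2) simp
      qed (use k seg in auto)
      then show "P (n * k) = P (n * ((k + 1) mod m))"
        by (simp only: mod_mult_mult1)
    qed (use c in auto)
    note b = segment_bounds[OF x]
    have m: "0 < m" using b(1) by simp
    show "P x = c"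
    \<comment> \<open>A vertex past the gap is followed forwards to the next start, any other vertex
      backwards to its own.\<close>
    proof (cases "\<exists>r\<in>R. r div n = x div n \<and> r < x")
      case True
      then obtain r where r: "r \<in> R" "r div n = x div n" "r < x" by auto
      have "P x = P ((n * (x div n + 1)) mod (n * m))"
      proof (rule const)
        fix k assume k: "x \<le> k" "k < n * (x div n + 1)"
        then have "k div n = r div n" using seg[of "x div n" k] b(2) r by auto
        then show "k \<notin> R" using inj_onD[OF inj, of k r] r k by auto
      qed (use x b in auto)
      also have "\<dots> = P (n * ((x div n + 1) mod m))" by (simp only: mod_mult_mult1)
      also have "\<dots> = c" using m by (intro start) simp
      finally show ?thesis .
    next
      case False
      have "P (n * (x div n)) = P (x mod (n * m))"
      proof (rule const)
        fix k assume k: "n * (x div n) \<le> k" "k < x"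
        then have "k div n = x div n" using seg[of "x div n" k] b(3) by auto
        then show "k \<notin> R" using False k by auto
      qed (use n x b in auto)
      then show ?thesis using start[OF b(1)] x by simp
    qed
  qed
qed

text \<open>The contraction is applied to the subgraph and to each of its single-edge deletions. A
  second gap in a broken segment violates injectivity and so always disconnects; only unbroken
  segments and spokes give conditions on the contracted rim.\<close>

lemma rim_tree_segments:
  assumes n: "0 < n" and R: "R \<subseteq> {..<n * m}" and D: "D \<subseteq> {..<m}"
  shows "rim_tree (n * m) R ((*) n ` D) \<longleftrightarrow>
    inj_on (\<lambda>i. i div n) R \<and> rim_tree m ((\<lambda>i. i div n) ` R) D"
proof (cases "inj_on (\<lambda>i. i div n) R")
  case inj: True
  let ?A = "(\<lambda>i. i div n) ` R"
  have "(\<forall>i<n * m. i \<notin> R \<longrightarrow> \<not> rim_connected (n * m) (insert i R) ((*) n ` D)) \<longleftrightarrow>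
      (\<forall>k<m. k \<notin> ?A \<longrightarrow> \<not> rim_connected m (insert k ?A) D)" (is "?L \<longleftrightarrow> ?R")
  proof
    assume L: ?L
    show ?R
    proof (intro allI impI)
      fix k assume k: "k < m" "k \<notin> ?A"
      \<comment> \<open>The first edge of the unbroken segment \<open>k\<close> serves as its
        representative.\<close>
      have "n * k < n * m" "n * k \<notin> R" using k n by (auto simp: image_iff)
      with L have "\<not> rim_connected (n * m) (insert (n * k) R) ((*) n ` D)" by auto
      then show "\<not> rim_connected m (insert k ?A) D"
        using rim_connected_segments[OF n _ D, of "insert (n * k) R"] inj k n R
        by (auto simp: inj_on_insert)
    qed
  next
    assume rhs: ?R
    show ?L
    proof (intro allI impI notI)
      fix i assume i: "i < n * m" "i \<notin> R"
        and "rim_connected (n * m) (insert i R) ((*) n ` D)"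
      then have "inj_on (\<lambda>i. i div n) (insert i R)" "rim_connected m (insert (i div n) ?A) D"
        using rim_connected_segments[OF n _ D, of "insert i R"] R by auto
      then show False using rhs i segment_bounds(1)[OF i(1)] by (auto simp: inj_on_insert)
    qed
  qed
  moreover have "(*) n ` D - {n * k} = (*) n ` (D - {k})" for k
    using n by auto
  then have "(\<forall>s\<in>(*) n ` D. \<not> rim_connected (n * m) R ((*) n ` D - {s})) \<longleftrightarrow>
      (\<forall>k\<in>D. \<not> rim_connected m ?A (D - {k}))"
    using inj D rim_connected_segments[OF n R, of "D - {k}" for k] by (simp add: subset_iff)
  ultimately show ?thesis
    using inj rim_connected_segments[OF n R D] unfolding rim_tree_def by simp
next
  case False
  then show ?thesis using rim_connected_segments[OF assms] by (simp add: rim_tree_def)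
qed

section \<open>Counting\<close>

definition wheel :: "nat \<Rightarrow> nat set \<Rightarrow> nat set \<Rightarrow> jvertex ugraph" where
  "wheel N R S =
     \<lparr> uverts = insert Centre (Rim ` {..<N}),
       uedges = (\<lambda>i. {Rim i, Rim ((i + 1) mod N)}) ` ({..<N} - R) \<union> (\<lambda>s. {Centre, Rim s}) ` S \<rparr>"

lemma jahangir_eq_wheel: "jahangir n m = wheel (n * m) {} ((*) n ` {..<m})"
  by (auto simp: jahangir_def wheel_def)

lemma simple_graph_wheel:
  assumes "2 \<le> N" "S \<subseteq> {..<N}"
  shows "simple_graph (wheel N R S)"
proof -
  have "(i + 1) mod N < N" "i \<noteq> (i + 1) mod N" if "i < N" for i
    using that assms by (cases "i + 1 = N"; auto)+
  then show ?thesis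
    using assms(2) unfolding simple_graph_def wheel_def by fastforce
qed

text \<open>On a rim of length two the edges starting at \<open>0\<close> and \<open>1\<close> would
  coincide, hence the bound \<open>3 \<le> N\<close>.\<close>

lemma rim_edge_eq_iff:
  assumes "3 \<le> N" "i < N" "j < N"
  shows "{Rim i, Rim ((i + 1) mod N)} = {Rim j, Rim ((j + 1) mod N)} \<longleftrightarrow> i = j"
proof -
  have "i = j" if "i = (j + 1) mod N" "(i + 1) mod N = j"
    using that assms by (cases "i + 1 = N"; cases "j + 1 = N") auto
  then show ?thesis by (auto simp: doubleton_eq_iff)
qed

lemma delete_rim_edge:
  assumes "3 \<le> N" "i < N"
  shows "delete_edge {Rim i, Rim ((i + 1) mod N)} (wheel N R S) = wheel N (insert i R) S"
proof -
  let ?f = "\<lambda>i. {Rim i, Rim ((i + 1) mod N)}"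
  have inj: "inj_on ?f {..<N}"
    using rim_edge_eq_iff[OF assms(1)] by (intro inj_onI) auto
  have "?f ` ({..<N} - insert i R) = ?f ` ({..<N} - R) - {?f i}"
    using inj_onD[OF inj] assms(2) by blast
  then show ?thesis
    by (simp add: wheel_def delete_edge_def Un_Diff) (auto simp: doubleton_eq_iff)
qed

lemma delete_spoke:
  "delete_edge {Centre, Rim s} (wheel N R S) = wheel N R (S - {s})"
  by (auto simp: wheel_def delete_edge_def doubleton_eq_iff)

lemma edge_invariant_wheel:
  "edge_invariant (wheel N R S) P \<longleftrightarrow>
     (\<forall>k<N. k \<notin> R \<longrightarrow> P (Rim k) = P (Rim ((k + 1) mod N))) \<and> (\<forall>k\<in>S. P (Rim k) = P Centre)"
proof
  assume inv: "edge_invariant (wheel N R S) P"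
  have "{Rim k, Rim ((k + 1) mod N)} \<in> uedges (wheel N R S)" if "k < N" "k \<notin> R" for k
    using that by (simp add: wheel_def)
  moreover have "{Rim k, Centre} \<in> uedges (wheel N R S)" if "k \<in> S" for k
    using that by (simp add: wheel_def insert_commute)
  ultimately show "(\<forall>k<N. k \<notin> R \<longrightarrow> P (Rim k) = P (Rim ((k + 1) mod N))) \<and>
      (\<forall>k\<in>S. P (Rim k) = P Centre)"
    using inv unfolding edge_invariant_def by blast
next
  assume "(\<forall>k<N. k \<notin> R \<longrightarrow> P (Rim k) = P (Rim ((k + 1) mod N))) \<and>
      (\<forall>k\<in>S. P (Rim k) = P Centre)"
  then show "edge_invariant (wheel N R S) P"
    by (auto simp: edge_invariant_def wheel_def doubleton_eq_iff)
qed

text \<open>A predicate on the vertices is the same as a value \<open>c\<close> at the centre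
  together with a predicate on the rim indices.\<close>

lemma connected_wheel_iff:
  assumes "2 \<le> N" "S \<subseteq> {..<N}"
  shows "connected_graph (wheel N R S) \<longleftrightarrow> rim_connected N R S"
proof -
  have "connected_graph (wheel N R S) \<longleftrightarrow>
      (\<forall>P. edge_invariant (wheel N R S) P \<longrightarrow> (\<forall>k<N. P (Rim k) = P Centre))"
    unfolding connected_graph_iff_edge_invariant[OF simple_graph_wheel[OF assms]]
    by (auto simp: wheel_def)
  also have "\<dots> \<longleftrightarrow> rim_connected N R S"
  proof
    assume *: "\<forall>P. edge_invariant (wheel N R S) P \<longrightarrow> (\<forall>k<N. P (Rim k) = P Centre)"
    show "rim_connected N R S"
      unfolding rim_connected_def
    proof (intro allI impI)
      fix P c k
      assume "\<forall>k<N. k \<notin> R \<longrightarrow> P k = P ((k + 1) mod N)" "\<forall>k\<in>S. P k = (c :: bool)" "k < N"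
      then show "P k = c"
        using *[rule_format, of "case_jvertex c P" k] by (simp add: edge_invariant_wheel)
    qed
  next
    assume "rim_connected N R S"
    from rim_connectedD[OF this, of "\<lambda>k. P (Rim k)" "P Centre" for P]
    show "\<forall>P. edge_invariant (wheel N R S) P \<longrightarrow> (\<forall>k<N. P (Rim k) = P Centre)"
      unfolding edge_invariant_wheel by blast
  qed
  finally show ?thesis .
qed

text \<open>Deleting an edge of a \<open>wheel\<close> gives another \<open>wheel\<close>, so each
  test for a bridge becomes a statement about \<open>rim_connected\<close>.\<close>

lemma spanning_tree_wheel_iff:
  assumes N: "3 \<le> N" and S: "S \<subseteq> S0" and S0: "S0 \<subseteq> {..<N}"
  shows "is_spanning_tree (wheel N R S) (wheel N {} S0) \<longleftrightarrow> rim_tree N R S"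
proof -
  have sub: "S \<subseteq> {..<N}" using S S0 by auto
  have N2: "2 \<le> N" using N by simp
  have "is_subgraph (wheel N R S) (wheel N {} S0)"
    using simple_graph_wheel[OF N2 sub] S by (auto simp: is_subgraph_def wheel_def)
  moreover have "acyclic_graph (wheel N R S) \<longleftrightarrow>
      (\<forall>k<N. k \<notin> R \<longrightarrow> \<not> rim_connected N (insert k R) S) \<and>
      (\<forall>k\<in>S. \<not> rim_connected N R (S - {k}))" if conn: "connected_graph (wheel N R S)"
  proof -
    have edges: "uedges (wheel N R S) =
        (\<lambda>i. {Rim i, Rim ((i + 1) mod N)}) ` ({..<N} - R) \<union> (\<lambda>s. {Centre, Rim s}) ` S"
      by (simp add: wheel_def)
    have "\<not> connected_graph (delete_edge {Rim i, Rim ((i + 1) mod N)} (wheel N R S)) \<longleftrightarrow>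
        \<not> rim_connected N (insert i R) S" if "i < N" for i
      using connected_wheel_iff[OF N2 sub] delete_rim_edge[OF N that] by simp
    moreover have "\<not> connected_graph (delete_edge {Centre, Rim s} (wheel N R S)) \<longleftrightarrow>
        \<not> rim_connected N R (S - {s})" for s
      using connected_wheel_iff[OF N2, of "S - {s}"] sub delete_spoke by auto
    ultimately show ?thesis
      unfolding acyclic_graph_iff_bridges[OF simple_graph_wheel[OF N2 sub] conn] edges ball_Un
      by auto
  qed
  ultimately show ?thesis
    using connected_wheel_iff[OF N2 sub]
    by (auto simp: is_spanning_tree_def rim_tree_def wheel_def)
qed

lemma spanning_subgraph_wheelE:
  assumes "is_spanning_tree T (wheel N {} S0)"
  obtains R S where "R \<subseteq> {..<N}" "S \<subseteq> S0" "T = wheel N R S"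
proof -
  define R where "R = {i. i < N \<and> {Rim i, Rim ((i + 1) mod N)} \<notin> uedges T}"
  define S where "S = {s \<in> S0. {Centre, Rim s} \<in> uedges T}"
  have "uverts T = insert Centre (Rim ` {..<N})"
    using assms by (simp add: is_spanning_tree_def wheel_def)
  moreover have "uedges T \<subseteq> uedges (wheel N {} S0)"
    using assms by (simp add: is_spanning_tree_def is_subgraph_def)
  then have "uedges T = uedges (wheel N R S)"
    unfolding wheel_def R_def S_def ugraph.simps
    by (intro set_eqI)
      (simp only: Un_iff image_iff Diff_iff lessThan_iff mem_Collect_eq subset_iff; blast)
  ultimately have "T = wheel N R S"
    by (simp add: wheel_def)
  moreover have "R \<subseteq> {..<N}" "S \<subseteq> S0" unfolding R_def S_def by blast+
  ultimately show ?thesis using that by blast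
qed

text \<open>The code can be read off the edges. The bounds on \<open>R\<close> and \<open>R'\<close>
  matter because indices from \<open>N\<close> on leave no trace in the graph.\<close>

lemma wheel_inject:
  assumes N: "3 \<le> N" and "R \<subseteq> {..<N}" "R' \<subseteq> {..<N}" and eq: "wheel N R S = wheel N R' S'"
  shows "R = R' \<and> S = S'"
proof -
  have rim: "{Rim i, Rim ((i + 1) mod N)} \<in> uedges (wheel N R S) \<longleftrightarrow> i \<notin> R"
    if "i < N" for i R S
    using rim_edge_eq_iff[OF N that] that by (auto simp: wheel_def)
  have spoke: "{Centre, Rim s} \<in> uedges (wheel N R S) \<longleftrightarrow> s \<in> S" for s R S
    by (auto simp: wheel_def doubleton_eq_iff)
  have "i \<in> R \<longleftrightarrow> i \<in> R'" for i
    using rim[of i R S] rim[of i R' S'] eq assms(2,3) by (cases "i < N") auto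
  moreover have "s \<in> S \<longleftrightarrow> s \<in> S'" for s
    using spoke[of s R S] spoke[of s R' S'] eq by simp
  ultimately show ?thesis by blast
qed

section \<open>Types of spanning trees and the counting formula\<close>

definition tree_types :: "nat \<Rightarrow> (nat set \<times> nat set) set" where
  "tree_types m = {(A, D). A \<subseteq> {..<m} \<and> D \<subseteq> {..<m} \<and> rim_tree m A D}"

lemma finite_tree_types: "finite (tree_types m)"
  by (rule finite_subset[of _ "Pow {..<m} \<times> Pow {..<m}"]) (auto simp: tree_types_def)

text \<open>All rim edges are gone and all spokes kept; losing spoke \<open>k\<close> isolates
  \<open>k\<close>. This type makes the counting sum positive.\<close>

lemma star_in_tree_types: "({..<m}, {..<m}) \<in> tree_types m"
proof -
  have "\<not> rim_connected m {..<m} ({..<m} - {k})" if "k < m" for k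
  proof
    assume "rim_connected m {..<m} ({..<m} - {k})"
    from rim_connectedD[OF this, of "\<lambda>i. i = k" False k] that show False by auto
  qed
  moreover have "rim_connected m {..<m} {..<m}" by (auto simp: rim_connected_def)
  ultimately show ?thesis by (auto simp: tree_types_def rim_tree_def)
qed

lemma transversal_div:
  fixes n :: nat
  assumes "f \<in> (\<Pi>\<^sub>E k\<in>A. {n * k..<n * k + n})" "k \<in> A"
  shows "f k div n = k"
proof -
  from assms have "f k \<in> {n * k..<n * k + n}" by (auto simp: PiE_iff)
  then show ?thesis by (intro div_nat_eqI) (auto simp: mult.commute)
qed

text \<open>Spanning trees correspond to codes \<open>(R, D)\<close>, and these to a type
  \<open>(A, D)\<close> with a choice of one deleted edge in each segment of \<open>A\<close>,
  \<open>n\<close> options each. The case \<open>n = 1\<close>, an ordinary wheel, is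
  included.\<close>

lemma num_spanning_trees_jahangir:
  assumes n: "1 \<le> n" and m: "3 \<le> m"
  shows "num_spanning_trees (jahangir n m) = (\<Sum>(A, D)\<in>tree_types m. n ^ card A)"
proof -
  define X where "X = {(R, D). R \<subseteq> {..<n * m} \<and> D \<subseteq> {..<m} \<and> rim_tree (n * m) R ((*) n ` D)}"
  \<comment> \<open>Choice functions for the positions of the gaps. Extensionality on
    \<open>A\<close> makes their number exactly \<open>n ^ card A\<close>.\<close>
  define F where "F = (\<lambda>(A :: nat set, D :: nat set). \<Pi>\<^sub>E k\<in>A. {n * k..<n * k + n})"
  have n0: "0 < n" and N: "3 \<le> n * m"
    using n m mult_le_mono[OF n m] by auto
  have S0: "(*) n ` {..<m} \<subseteq> {..<n * m}" using n0 by auto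
  have "bij_betw (\<lambda>(R, D). wheel (n * m) R ((*) n ` D)) X {T. is_spanning_tree T (jahangir n m)}"
    unfolding bij_betw_def jahangir_eq_wheel
  proof
    have "inj ((*) n)" using n0 by (simp add: inj_on_def)
    then have "R = R' \<and> D = D'"
      if "(R, D) \<in> X" "(R', D') \<in> X" "wheel (n * m) R ((*) n ` D) = wheel (n * m) R' ((*) n ` D')"
      for R D R' D'
      using wheel_inject[OF N _ _ that(3)] that(1,2) by (simp add: X_def inj_image_eq_iff)
    then show "inj_on (\<lambda>(R, D). wheel (n * m) R ((*) n ` D)) X"
      by (intro inj_onI) (simp only: split_paired_all prod.case prod.inject)
    show "(\<lambda>(R, D). wheel (n * m) R ((*) n ` D)) ` X =
        {T. is_spanning_tree T (wheel (n * m) {} ((*) n ` {..<m}))}" (is "?l = ?r")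
    proof
      show "?l \<subseteq> ?r"
        using spanning_tree_wheel_iff[OF N _ S0] by (auto simp: X_def image_mono)
      show "?r \<subseteq> ?l"
      proof
        fix T assume T: "T \<in> ?r"
        then obtain R S where RS: "R \<subseteq> {..<n * m}" "S \<subseteq> (*) n ` {..<m}" "T = wheel (n * m) R S"
          using spanning_subgraph_wheelE by blast
        then obtain D where D: "D \<subseteq> {..<m}" "S = (*) n ` D" by (auto simp: subset_image_iff)
        then have "(R, D) \<in> X"
          using T RS spanning_tree_wheel_iff[OF N RS(2) S0] by (auto simp: X_def)
        then show "T \<in> ?l" using RS D by force
      qed
    qed
  qed
  then have "num_spanning_trees (jahangir n m) = card X"
    by (simp add: num_spanning_trees_def bij_betw_same_card)
  also have "\<dots> = card (Sigma (tree_types m) F)"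
  proof (rule bij_betw_same_card[symmetric])
    show "bij_betw (\<lambda>((A, D), f). (f ` A, D)) (Sigma (tree_types m) F) X"
      unfolding bij_betw_def
    proof
      show "inj_on (\<lambda>((A, D), f). (f ` A, D)) (Sigma (tree_types m) F)"
      proof (rule inj_onI, clarsimp simp: F_def)
        fix A A' D f g
        assume f: "f \<in> (\<Pi>\<^sub>E k\<in>A. {n * k..<n * k + n})" and g: "g \<in> (\<Pi>\<^sub>E k\<in>A'. {n * k..<n * k + n})"
          and eq: "f ` A = g ` A'"
        \<comment> \<open>Division by \<open>n\<close> recovers the segment of a deleted edge, so
          the image determines first \<open>A\<close> and then the function.\<close>
        have "(\<lambda>i. i div n) ` f ` A = A" "(\<lambda>i. i div n) ` g ` A' = A'"
          using transversal_div[OF f] transversal_div[OF g] by (auto simp: image_image)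
        then have A: "A = A'" using eq by simp
        have "f k = g k" if k: "k \<in> A" for k
        proof -
          from k eq obtain l where l: "l \<in> A'" "f k = g l" by (metis imageE imageI)
          then show ?thesis
            using transversal_div[OF f k] transversal_div[OF g l(1)] by simp
        qed
        then show "A = A' \<and> f = g" using f g A by (auto intro: PiE_ext)
      qed
      show "(\<lambda>((A, D), f). (f ` A, D)) ` Sigma (tree_types m) F = X"
      proof (intro equalityI subsetI)
        fix z assume "z \<in> (\<lambda>((A, D), f). (f ` A, D)) ` Sigma (tree_types m) F"
        then obtain A D f where z: "z = (f ` A, D)" and AD: "(A, D) \<in> tree_types m"
          and f: "f \<in> (\<Pi>\<^sub>E k\<in>A. {n * k..<n * k + n})" by (auto simp: F_def)
        have A: "A \<subseteq> {..<m}" and D: "D \<subseteq> {..<m}" and t: "rim_tree m A D"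
          using AD by (auto simp: tree_types_def)
        note dv = transversal_div[OF f]
        have R: "f ` A \<subseteq> {..<n * m}"
        proof (rule image_subsetI)
          fix k assume k: "k \<in> A"
          have "f k < n * k + n" using f k by (auto simp: PiE_iff)
          also have "\<dots> = n * (k + 1)" by simp
          also have "\<dots> \<le> n * m" using k A by (intro mult_le_mono2) auto
          finally show "f k \<in> {..<n * m}" by simp
        qed
        have "(\<lambda>i. i div n) ` f ` A = A" using dv by (auto simp: image_image)
        moreover have "inj_on (\<lambda>i. i div n) (f ` A)"
          using dv by (auto simp: inj_on_def)
        ultimately show "z \<in> X"
          using rim_tree_segments[OF n0 R D] t R D by (simp add: X_def z)
      next
        fix z assume "z \<in> X"
        then obtain R D where z: "z = (R, D)" and R: "R \<subseteq> {..<n * m}" and D: "D \<subseteq> {..<m}"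
          and t: "rim_tree (n * m) R ((*) n ` D)" by (auto simp: X_def)
        define A where "A = (\<lambda>i. i div n) ` R"
        \<comment> \<open>The function sends a segment to its unique deleted edge; the restriction
          makes it extensional.\<close>
        define f where "f = restrict (the_inv_into R (\<lambda>i. i div n)) A"
        have inj: "inj_on (\<lambda>i. i div n) R" and t': "rim_tree m A D"
          using t rim_tree_segments[OF n0 R D] by (auto simp: A_def)
        have f_div: "f (r div n) = r" if "r \<in> R" for r
          using that the_inv_into_f_f[OF inj that] by (simp add: f_def A_def)
        have "f \<in> (\<Pi>\<^sub>E k\<in>A. {n * k..<n * k + n})"
        proof (rule PiE_I)
          fix k assume "k \<in> A"
          then obtain r where r: "r \<in> R" "k = r div n" by (auto simp: A_def)
          then show "f k \<in> {n * k..<n * k + n}"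
            using f_div[OF r(1)] dividend_less_times_div[OF n0, of r] by (simp add: add.commute)
        qed (simp add: f_def)
        moreover have "A \<subseteq> {..<m}"
          using R segment_bounds(1)[of _ n m] by (auto simp: A_def)
        moreover have "f ` A = R" using f_div by (force simp: A_def)
        ultimately show "z \<in> (\<lambda>((A, D), f). (f ` A, D)) ` Sigma (tree_types m) F"
          using t' D by (intro image_eqI[of _ _ "((A, D), f)"]) (auto simp: z tree_types_def F_def)
      qed
    qed
  qed
  also have "\<dots> = (\<Sum>p\<in>tree_types m. card (F p))"
  proof (rule card_SigmaI[OF finite_tree_types], intro ballI)
    fix p assume "p \<in> tree_types m"
    then have "finite (fst p)" by (auto simp: tree_types_def finite_subset[OF _ finite_lessThan])
    then show "finite (F p)" by (auto simp: F_def case_prod_unfold intro!: finite_PiE)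
  qed
  also have "\<dots> = (\<Sum>(A, D)\<in>tree_types m. n ^ card A)"
  proof (rule sum.cong[OF refl], clarify)
    fix A D assume "(A, D) \<in> tree_types m"
    then have "finite A" by (auto simp: tree_types_def finite_subset[OF _ finite_lessThan])
    then show "card (F (A, D)) = n ^ card A" by (simp add: F_def card_PiE)
  qed
  finally show ?thesis .
qed

section \<open>The limit of the ratio\<close>

theorem theorem3p1:
  fixes m :: nat
  assumes "m > 2"
  shows "(\<lambda>n. real (num_spanning_trees (jahangir n m)) /
              real (num_spanning_trees (jahangir (n - 1) m))) \<longlonglongrightarrow> 1"
proof -
  define s where "s = (\<lambda>n. num_spanning_trees (jahangir n m))"
  have s: "real (s n) = (\<Sum>(A, D)\<in>tree_types m. real n ^ card A)" if "1 \<le> n" for n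
    using num_spanning_trees_jahangir[OF that] assms by (simp add: s_def case_prod_unfold)
  \<comment> \<open>From \<open>n = 2\<close> on, the counting formula applies to
    \<open>n - 1\<close> as well. The upper bound holds term by term, since
    \<open>n / (n - 1)\<close> is at least \<open>1\<close> and each exponent \<open>card A\<close>
    is at most \<open>m\<close>.\<close>
  have bounds: "1 \<le> real (s n) / real (s (n - 1)) \<and>
      real (s n) / real (s (n - 1)) \<le> (real n / real (n - 1)) ^ m" if n: "2 \<le> n" for n
  proof -
    have "0 < real (s (n - 1))"
      using n star_in_tree_types[of m]
      by (subst s) (auto intro!: sum_pos finite_tree_types)
    moreover have "real (s (n - 1)) \<le> real (s n)"
      using n by (subst (1 2) s) (auto intro!: sum_mono power_mono)
    moreover have "real (s n) \<le> (real n / real (n - 1)) ^ m * real (s (n - 1))"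
    proof -
      have "real n ^ card A \<le> (real n / real (n - 1)) ^ m * real (n - 1) ^ card A"
        if "(A, D) \<in> tree_types m" for A D
      proof -
        have "card A \<le> m"
          using that card_mono[of "{..<m}" A] by (auto simp: tree_types_def)
        then have "(real n / real (n - 1)) ^ card A \<le> (real n / real (n - 1)) ^ m"
          using n by (intro power_increasing) auto
        then have "(real n / real (n - 1)) ^ card A * real (n - 1) ^ card A
            \<le> (real n / real (n - 1)) ^ m * real (n - 1) ^ card A"
          by (rule mult_right_mono) simp
        moreover have "(real n / real (n - 1)) ^ card A * real (n - 1) ^ card A = real n ^ card A"
          using n by (simp add: power_mult_distrib[symmetric])
        ultimately show ?thesis by simp
      qed
      then show ?thesis
        using n by (subst (1 2) s) (auto simp: sum_distrib_left intro!: sum_mono)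
    qed
    ultimately show ?thesis by (simp add: field_simps)
  qed
  have "(\<lambda>n. real n / real (n - 1)) \<longlonglongrightarrow> 1"
    \<comment> \<open>Shifting the index turns the sequence into \<open>Suc n / n\<close>.\<close>
    by (rule LIMSEQ_imp_Suc) (use LIMSEQ_Suc_n_over_n[where 'a = real] in simp)
  from tendsto_power[OF this, of m] have lim: "(\<lambda>n. (real n / real (n - 1)) ^ m) \<longlonglongrightarrow> 1"
    by simp
  have "(\<lambda>n. real (s n) / real (s (n - 1))) \<longlonglongrightarrow> 1"
    by (rule tendsto_sandwich[OF _ _ tendsto_const lim];
        rule eventually_sequentiallyI[of 2]; use bounds in blast)
  then show ?thesis by (simp add: s_def)
qed

end
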